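(* Let $\alpha,\beta$ be parameters, $n\ge1$, $x_1,\dots,x_n$ variables and $\lambda$ a partition. Then $g^{(\alpha,\beta)}_\lambda(x_1,\dots,x_n)$ equals the partition function of the following lattice model: $n$ rows with bosonic horizontal labels (nonnegative integers), row $k$ (from the bottom) having parameter $x_k$, bottom boundary all $0$, top boundary $(m_j(\lambda))_{j\ge1}$, right boundary value $0$, free left boundary, and vertex weights $$w_x(a,b;c,d)=\delta_{a+b,c+d}\begin{cases}(\alpha+\beta)^{a-d-1}(x+\alpha)\beta^{d}& a>d,\\ \beta^{a-1}x& 0<a\le d,\\ 1& a=0.\end{cases}$$
   Context: Dual canonical Grothendieck polynomials. For partitions $\mu\subseteq\lambda$ let $r(\lambda/\mu)$, $c(\lambda/\mu)$, $b(\lambda/\mu)$ be the numbers of nonempty rows, nonempty columns, and edge-connected components of the skew diagram $\lambda/\mu$. The polynomials $g^{(\alpha,\beta)}_\lambda$ are determined by: with no variables, $g^{(\alpha,\beta)}_\lambda()=1$ if $\lambda=\emptyset$ and $0$ otherwise; and $g^{(\alpha,\beta)}_\lambda(x_1,\dots,x_{n+1})=\sum_{\mu\subseteq\lambda}g^{(\alpha,\beta)}_\mu(x_1,\dots,x_n)\,g^{(\alpha,\beta)}_{\lambda/\mu}(x_{n+1})$ with $g^{(\alpha,\beta)}_{\lambda/\mu}(x)=\beta^{r-b}(\alpha+\beta)^{|\lambda|-|\mu|-r-c+b}x^{b}(\alpha+x)^{c-b}$, where $r,c,b$ denote $r(\lambda/\mu),c(\lambda/\mu),b(\lambda/\mu)$.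 Lattice conventions. A vertex has left label $a$, bottom label $b$, right label $c$, top label $d$. A row with parameter $x$ is a sequence of vertices at sites $j=1,2,\dots$, the right label at site $j$ being the left label at site $j+1$; vertical labels are nonnegative integers; the left label at site 1 is free (summed over all values) and the right labels must be eventually equal to the prescribed right boundary value. Rows $1,\dots,n$ are stacked bottom to top, top labels of row $k$ = bottom labels of row $k+1$; bottom labels of row 1 and top labels of row $n$ are prescribed. The partition function is the sum over all labelings of non-prescribed edges of the product of the vertex weights. $m_j(\lambda)$ is the number of parts of $\lambda$ equal to $j$. *)

theory Defs
  imports Complex_Main "HOL-Library.FuncSet"
begin

text \<open>Partitions are weakly decreasing lists of positive parts, so that the empty partition is
  \<open>[]\<close> and the representation is unique; the diagram is indexed from 0.\<close>

definition is_partition :: "nat list \<Rightarrow> bool" where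
  "is_partition la \<longleftrightarrow> sorted_wrt (\<ge>) la \<and> 0 \<notin> set la"

definition diagram :: "nat list \<Rightarrow> (nat \<times> nat) set" where
  "diagram la = {(i, j). i < length la \<and> j < la ! i}"

definition skew_diagram :: "nat list \<Rightarrow> nat list \<Rightarrow> (nat \<times> nat) set" where
  "skew_diagram la mu = diagram la - diagram mu"

definition nrows :: "nat list \<Rightarrow> nat list \<Rightarrow> nat" where
  "nrows la mu = card (fst ` skew_diagram la mu)"

definition ncols :: "nat list \<Rightarrow> nat list \<Rightarrow> nat" where
  "ncols la mu = card (snd ` skew_diagram la mu)"

definition edge_adjacent :: "nat \<times> nat \<Rightarrow> nat \<times> nat \<Rightarrow> bool" where
  "edge_adjacent p q \<longleftrightarrow>
     fst p = fst q \<and> (snd p = Suc (snd q) \<or> snd q = Suc (snd p)) \<or>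
     snd p = snd q \<and> (fst p = Suc (fst q) \<or> fst q = Suc (fst p))"

definition edge_components :: "(nat \<times> nat) set \<Rightarrow> (nat \<times> nat) set set" where
  "edge_components S = S // {(p, q). p \<in> S \<and> q \<in> S \<and> edge_adjacent p q}\<^sup>*"

definition ncomps :: "nat list \<Rightarrow> nat list \<Rightarrow> nat" where
  "ncomps la mu = card (edge_components (skew_diagram la mu))"

text \<open>The truncated subtractions are exact: every row and every column of a skew diagram lies in
  one edge-connected component, and a connected skew diagram with \<open>r\<close> rows and \<open>c\<close> columns has
  at least \<open>r + c - 1\<close> cells.\<close>

definition dual_groth_skew1 ::
    "'a::comm_ring_1 \<Rightarrow> 'a \<Rightarrow> nat list \<Rightarrow> nat list \<Rightarrow> 'a \<Rightarrow> 'a" where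
  "dual_groth_skew1 \<alpha> \<beta> la mu x =
     (let r = nrows la mu; c = ncols la mu; b = ncomps la mu
      in \<beta> ^ (r - b) * (\<alpha> + \<beta>) ^ ((sum_list la + b) - (sum_list mu + r + c))
           * x ^ b * (\<alpha> + x) ^ (c - b))"

text \<open>\<open>dual_groth \<alpha> \<beta> x n la\<close> only uses the values \<open>x 1, \<dots>, x n\<close> of \<open>x\<close>.\<close>

primrec dual_groth ::
    "'a::comm_ring_1 \<Rightarrow> 'a \<Rightarrow> (nat \<Rightarrow> 'a) \<Rightarrow> nat \<Rightarrow> nat list \<Rightarrow> 'a" where
  "dual_groth \<alpha> \<beta> x 0 la = (if la = [] then 1 else 0)"
| "dual_groth \<alpha> \<beta> x (Suc n) la =
     (\<Sum>mu | is_partition mu \<and> diagram mu \<subseteq> diagram la.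
        dual_groth \<alpha> \<beta> x n mu * dual_groth_skew1 \<alpha> \<beta> la mu (x (Suc n)))"

definition vertex_weight ::
    "'a::comm_ring_1 \<Rightarrow> 'a \<Rightarrow> 'a \<Rightarrow> nat \<Rightarrow> nat \<Rightarrow> nat \<Rightarrow> nat \<Rightarrow> 'a" where
  "vertex_weight \<alpha> \<beta> x a b c d =
     (if a + b = c + d then
        (if a > d then (\<alpha> + \<beta>) ^ (a - d - 1) * (x + \<alpha>) * \<beta> ^ d
         else if 0 < a then \<beta> ^ (a - 1) * x
         else 1)
      else 0)"

text \<open>A labeling is a pair \<open>(h, v)\<close>. For the vertex in row \<open>k \<in> {1..n}\<close> at site \<open>j \<ge> 1\<close>, the
  left, bottom, right and top labels are \<open>h (k, j - 1)\<close>, \<open>v (k - 1, j)\<close>, \<open>h (k, j)\<close> and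
  \<open>v (k, j)\<close>. In particular the unconstrained \<open>h (k, 0)\<close> is the free left boundary.\<close>

type_synonym labeling = "(nat \<times> nat \<Rightarrow> nat) \<times> (nat \<times> nat \<Rightarrow> nat)"

definition labelings :: "nat \<Rightarrow> (nat \<Rightarrow> nat) \<Rightarrow> (nat \<Rightarrow> nat) \<Rightarrow> nat \<Rightarrow> labeling set" where
  "labelings n bottom_lab top_lab right_lab =
     {(h, v). h \<in> {1..n} \<times> UNIV \<rightarrow>\<^sub>E UNIV \<and> v \<in> {0..n} \<times> {1..} \<rightarrow>\<^sub>E UNIV \<and>
        (\<forall>j\<ge>1. v (0, j) = bottom_lab j) \<and> (\<forall>j\<ge>1. v (n, j) = top_lab j) \<and>
        (\<forall>k\<in>{1..n}. \<forall>\<^sub>F j in sequentially. h (k, j) = right_lab)}"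

text \<open>Product of a family that contains a zero factor or has only finitely many factors different
  from 1. If no vertex weight of a labeling with right boundary value 0 vanishes, the horizontal
  labels of each of the finitely many rows are eventually 0, so all but finitely many vertices
  have left label 0 and weight 1.\<close>

definition prod_factors :: "('i \<Rightarrow> 'a::comm_ring_1) \<Rightarrow> 'i set \<Rightarrow> 'a" where
  "prod_factors f S = (if \<exists>i\<in>S. f i = 0 then 0 else (\<Prod>i | i \<in> S \<and> f i \<noteq> 1. f i))"

definition labeling_weight ::
    "'a::comm_ring_1 \<Rightarrow> 'a \<Rightarrow> (nat \<Rightarrow> 'a) \<Rightarrow> nat \<Rightarrow> labeling \<Rightarrow> 'a" where
  "labeling_weight \<alpha> \<beta> x n = (\<lambda>(h, v).
     prod_factors
       (\<lambda>(k, j). vertex_weight \<alpha> \<beta> (x k) (h (k, j - 1)) (v (k - 1, j)) (h (k, j)) (v (k, j)))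
       ({1..n} \<times> {1..}))"

text \<open>The sum over all labelings is taken over those of nonzero weight. For right boundary 0 and
  finitely supported bottom and top labels there are finitely many of these: conservation at every
  vertex gives \<open>h (k, j - 1) = (\<Sum>i\<ge>j. v (k, i) - v (k - 1, i)) \<ge> 0\<close>, so the horizontal labels
  are determined by the vertical ones, and the tail sums of \<open>v (k, _)\<close> increase with \<open>k\<close> and are
  bounded by those of the top boundary.\<close>

definition partition_function ::
    "'a::comm_ring_1 \<Rightarrow> 'a \<Rightarrow> (nat \<Rightarrow> 'a) \<Rightarrow> nat \<Rightarrow> (nat \<Rightarrow> nat) \<Rightarrow> (nat \<Rightarrow> nat) \<Rightarrow> nat \<Rightarrow> 'a" where
  "partition_function \<alpha> \<beta> x n bottom_lab top_lab right_lab =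
     (\<Sum>l | l \<in> labelings n bottom_lab top_lab right_lab \<and> labeling_weight \<alpha> \<beta> x n l \<noteq> 0.
        labeling_weight \<alpha> \<beta> x n l)"

end

theory Submission
  imports Defs "HOL-Library.Multiset"
begin

text \<open>Conservation at every vertex identifies the vertical labels above row \<open>k\<close> with the part
  multiplicities of a partition \<open>\<lambda>\<^sup>k\<close>, and the left label at site \<open>j\<close> of row \<open>k\<close> with the number
  \<open>a\<close> of cells in column \<open>j\<close> of \<open>\<lambda>\<^sup>k/\<lambda>\<^sup>k\<^sup>-\<^sup>1\<close>. Columns \<open>j\<close> and \<open>j + 1\<close> share \<open>a - d\<close>
  rows, where \<open>d\<close> is the top label, so the vertices with \<open>0 < a \<le> d\<close> mark the last columns of the
  edge-connected components. Moreover \<open>min a d\<close> rows of the skew diagram end in column \<open>j\<close>. Hence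
  the weights of a row multiply to the one-variable skew polynomial, and both sides satisfy the
  same branching rule in the number of rows.\<close>

section \<open>Column heights of partitions\<close>

text \<open>The conjugate partition: with columns indexed from 0, column \<open>j\<close> meets
  exactly the parts larger than \<open>j\<close>. Containment, rows, columns and components are all
  read off from it.\<close>

definition col_height :: "nat list \<Rightarrow> nat \<Rightarrow> nat" where
  "col_height la j = length (filter (\<lambda>p. j < p) la)"

text \<open>The parts of a weakly decreasing list that exceed \<open>j\<close> form an initial
  segment, so their number decides which rows reach column \<open>j\<close>.\<close>

lemma mem_diagram_iff_col_height:
  assumes "sorted_wrt (\<ge>) la"
  shows "(i, j) \<in> diagram la \<longleftrightarrow> i < col_height la j"
  using assms
proof (induction la arbitrary: i)
  case Nil
  then show ?case by (simp add: diagram_def col_height_def)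
next
  case (Cons p la)
  show ?case
  proof (cases "j < p")
    case True
    then show ?thesis
      using Cons by (cases i) (auto simp: diagram_def col_height_def)
  next
    case False
    with Cons.prems have *: "\<forall>q \<in> set (p # la). q \<le> j"
      by auto
    then have "filter (\<lambda>q. j < q) (p # la) = []"
      by (auto simp: filter_empty_conv)
    moreover have "(i, j) \<notin> diagram (p # la)"
      using * by (metis (no_types, lifting) case_prodD diagram_def leD mem_Collect_eq nth_mem)
    ultimately show ?thesis
      by (simp add: col_height_def)
  qed
qed

text \<open>The rows ending in column \<open>j\<close> are the parts equal to \<open>Suc j\<close>.
  This is the passage from columns, counted from 0, to lattice sites, counted from 1.\<close>

lemma col_height_Suc: "col_height la j = col_height la (Suc j) + count_list la (Suc j)"
  by (induction la) (auto simp: col_height_def)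

lemma antimono_col_height: "antimono (col_height la)"
  by (rule decseq_SucI) (subst (2) col_height_Suc, simp)

lemma col_height_eq_0: "sum_list la \<le> j \<Longrightarrow> col_height la j = 0"
  by (auto simp: col_height_def filter_empty_conv dest: member_le_sum_list)

lemma sum_col_height:
  assumes "\<forall>p\<in>set la. p \<le> N"
  shows "(\<Sum>j<N. col_height la j) = sum_list la"
  using assms
proof (induction la)
  case Nil
  then show ?case by (simp add: col_height_def)
next
  case (Cons p la)
  have "col_height (p # la) j = of_bool (j < p) + col_height la j" for j
    by (simp add: col_height_def)
  moreover have "(\<Sum>j<N. of_bool (j < p)) = p"
  proof -
    have "{..<N} \<inter> {j. j < p} = {..<p}"
      using Cons.prems by auto
    then show ?thesis by simp
  qed
  ultimately show ?case
    using Cons by (simp add: sum.distrib)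
qed

lemma diagram_subset_iff_col_height:
  assumes "is_partition la" "is_partition mu"
  shows "diagram mu \<subseteq> diagram la \<longleftrightarrow> (\<forall>j. col_height mu j \<le> col_height la j)"
proof -
  have "diagram mu \<subseteq> diagram la \<longleftrightarrow> (\<forall>j i. i < col_height mu j \<longrightarrow> i < col_height la j)"
    using assms by (auto simp: subset_iff is_partition_def mem_diagram_iff_col_height)
  also have "\<dots> \<longleftrightarrow> (\<forall>j. col_height mu j \<le> col_height la j)"
    by (meson leI less_le_trans nat_less_le order_less_irrefl)
  finally show ?thesis .
qed

lemma skew_diagram_col_height:
  assumes "is_partition la" "is_partition mu"
  shows "skew_diagram la mu = {(i, j). col_height mu j \<le> i \<and> i < col_height la j}"
  using assms by (auto simp: skew_diagram_def is_partition_def mem_diagram_iff_col_height)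

section \<open>Partitions and their multiplicities\<close>

lemma partition_eqI:
  assumes "is_partition la" "is_partition mu"
    and "\<And>j. j \<ge> 1 \<Longrightarrow> count_list la j = count_list mu j"
  shows "la = mu"
proof -
  have "count_list la j = count_list mu j" for j
    using assms by (cases "j = 0") (auto simp: is_partition_def count_list_0_iff)
  then have "mset (rev la) = mset (rev mu)"
    by (simp add: multiset_eq_iff count_mset)
  moreover have "sorted (rev la)" "sorted (rev mu)"
    using assms by (auto simp: is_partition_def sorted_wrt_rev)
  ultimately have "rev la = rev mu"
    by (metis properties_for_sort)
  then show ?thesis by simp
qed

lemma ex_partition_count_list:
  assumes "finite {j. j \<ge> 1 \<and> m j \<noteq> (0::nat)}"
  shows "\<exists>mu. is_partition mu \<and> (\<forall>j\<ge>1. count_list mu j = m j)"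
proof -
  \<comment> \<open>Multiplicity 0 is forced at the value 0, since a partition has only positive
    parts.\<close>
  define M where "M = Abs_multiset (\<lambda>j. if j \<ge> 1 then m j else 0)"
  have "{j. 0 < (if j \<ge> 1 then m j else 0)} = {j. j \<ge> 1 \<and> m j \<noteq> 0}"
    by auto
  then have M: "count M j = (if j \<ge> 1 then m j else 0)" for j
    using assms by (simp add: M_def count_Abs_multiset)
  define mu where "mu = rev (sorted_list_of_multiset M)"
  have "count_list mu j = count M j" for j
    by (metis count_mset mset_rev mset_sorted_list_of_multiset mu_def)
  moreover have "is_partition mu"
    using M[of 0] by (simp add: is_partition_def mu_def sorted_wrt_rev not_in_iff)
  ultimately show ?thesis
    using M by auto
qed

text \<open>The last cell of each row of \<open>mu\<close> bounds its part, and the first cell of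
  the last row bounds the length. Hence the branching sum is finite.\<close>

lemma finite_subpartitions: "finite {mu. is_partition mu \<and> diagram mu \<subseteq> diagram la}"
proof (rule finite_subset)
  show "{mu. is_partition mu \<and> diagram mu \<subseteq> diagram la}
      \<subseteq> {mu. set mu \<subseteq> {..sum_list la} \<and> length mu \<le> length la}"
  proof safe
    fix mu p
    assume "is_partition mu" and sub: "diagram mu \<subseteq> diagram la" and "p \<in> set mu"
    then obtain i where i: "i < length mu" "mu ! i = p" "p > 0"
      by (metis bot_nat_0.not_eq_extremum in_set_conv_nth is_partition_def)
    then have "(i, p - 1) \<in> diagram mu"
      by (simp add: diagram_def)
    with sub have "i < length la" "p - 1 < la ! i"
      by (auto simp: diagram_def)
    then have "p \<le> la ! i" "la ! i \<le> sum_list la"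
      by (auto intro: member_le_sum_list)
    then show "p \<le> sum_list la" by simp
  next
    fix mu
    assume mu: "is_partition mu" and sub: "diagram mu \<subseteq> diagram la"
    show "length mu \<le> length la"
    proof (cases "length mu")
      case (Suc i)
      then have "mu ! i > 0"
        using mu by (metis gr0I is_partition_def lessI nth_mem)
      with Suc have "(i, 0) \<in> diagram mu"
        by (simp add: diagram_def)
      with sub Suc show ?thesis
        by (auto simp: diagram_def)
    qed simp
  qed
  show "finite {mu. set mu \<subseteq> {..sum_list la} \<and> length mu \<le> length la}"
    by (rule finite_lists_length_le) simp
qed

section \<open>Rows, columns and components of a skew diagram\<close>

text \<open>\<open>f\<close> is a complete invariant of connectivity: it is constant along
  \<open>R\<close>, and each point of \<open>S\<close> is linked to a base point
  \<open>c (f p)\<close> that depends only on its value.\<close>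

lemma card_quotient_rtrancl_eq_card_image:
  assumes sym: "sym R"
    and inv: "\<And>p q. (p, q) \<in> R \<Longrightarrow> f p = f q"
    and conn: "\<And>p. p \<in> S \<Longrightarrow> (p, c (f p)) \<in> R\<^sup>*"
  shows "card (S // R\<^sup>*) = card (f ` S)"
proof -
  have inv': "f p = f q" if "(p, q) \<in> R\<^sup>*" for p q
    using that by induction (auto dest: inv)
  have "R\<^sup>* `` {p} = R\<^sup>* `` {c (f p)}" if "p \<in> S" for p
  proof -
    have "(c (f p), p) \<in> R\<^sup>*"
      using conn[OF that] sym_rtrancl[OF sym] by (auto dest: symD)
    then show ?thesis
      using conn[OF that] by (auto intro: rtrancl_trans)
  qed
  then have "S // R\<^sup>* = (\<lambda>y. R\<^sup>* `` {c y}) ` f ` S"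
    by (auto simp: quotient_def image_iff)
  moreover have "inj_on (\<lambda>y. R\<^sup>* `` {c y}) (f ` S)"
  proof (rule inj_onI, safe)
    fix p q
    assume "p \<in> S" "q \<in> S" "R\<^sup>* `` {c (f p)} = R\<^sup>* `` {c (f q)}"
    then have "(c (f p), c (f q)) \<in> R\<^sup>*" by auto
    then have "f (c (f p)) = f (c (f q))" by (rule inv')
    then show "f p = f q"
      using inv'[OF conn[OF \<open>p \<in> S\<close>]] inv'[OF conn[OF \<open>q \<in> S\<close>]] by simp
  qed
  ultimately show ?thesis
    by (simp add: card_image)
qed

text \<open>\<open>u\<close> and \<open>t\<close> stand for the column heights of the inner and the
  outer shape, both vanishing from column \<open>N\<close> on. The left, bottom, right and top
  labels at column \<open>j\<close> are then differences of their values at \<open>j\<close> and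
  \<open>Suc j\<close>.\<close>

locale skew_columns =
  fixes u t :: "nat \<Rightarrow> nat" and N :: nat
  assumes antimono_u: "antimono u" and antimono_t: "antimono t"
    and u_le_t: "\<And>j. u j \<le> t j" and t_eq_0: "\<And>j. N \<le> j \<Longrightarrow> t j = 0"
begin

definition cells :: "(nat \<times> nat) set" where
  "cells = {(i, j). u j \<le> i \<and> i < t j}"

lemma less_N: "i < t j \<Longrightarrow> j < N"
  by (metis not_less_zero not_le t_eq_0)

lemma card_columns: "card (snd ` cells) = card {j. j < N \<and> u j < t j}"
proof -
  have "snd ` cells = {j. j < N \<and> u j < t j}"
    by (force simp: cells_def dest: less_N)
  then show ?thesis by simp
qed

text \<open>Each nonempty row is counted in the column of its last cell.\<close>

lemma card_rows: "card (fst ` cells) = (\<Sum>j<N. min (t j - u j) (t j - t (Suc j)))"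
proof -
  have "fst ` cells = (\<Union>j<N. {max (u j) (t (Suc j)) ..< t j})"
  proof safe
    fix i j
    assume "(i, j) \<in> cells"
    then have ij: "u j \<le> i" "i < t j" by (auto simp: cells_def)
    \<comment> \<open>\<open>J\<close> is the last column that row \<open>i\<close> reaches. Going
      right from \<open>j\<close> can only lower \<open>u\<close>, so the cell in column
      \<open>J\<close> still belongs to the skew shape.\<close>
    define J where "J = (GREATEST k. i < t k)"
    have bd: "\<And>k. i < t k \<Longrightarrow> k \<le> N" by (auto dest: less_N)
    have J: "i < t J"
      unfolding J_def by (rule GreatestI_nat[of "\<lambda>k. i < t k" j N]) (use ij bd in auto)
    have le: "k \<le> J" if "i < t k" for k
      unfolding J_def by (rule Greatest_le_nat[of "\<lambda>k. i < t k" k N]) (use that bd in auto)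
    have "t (Suc J) \<le> i" using le[of "Suc J"] by (metis not_less_eq_eq order_refl not_le)
    moreover have "u J \<le> i"
      using le[OF ij(2)] antimonoD[OF antimono_u, of j J] ij(1) by auto
    ultimately show "fst (i, j) \<in> (\<Union>j<N. {max (u j) (t (Suc j)) ..< t j})"
      using J less_N[OF J] by auto
  next
    fix i j
    assume "i \<in> {max (u j) (t (Suc j)) ..< t j}"
    then have "(i, j) \<in> cells" by (auto simp: cells_def)
    then show "i \<in> fst ` cells" by (force simp: image_iff)
  qed
  moreover have "card (\<Union>j<N. {max (u j) (t (Suc j)) ..< t j})
      = (\<Sum>j<N. card {max (u j) (t (Suc j)) ..< t j})"
  proof (rule card_UN_disjoint)
    \<comment> \<open>For \<open>j < k\<close> the interval of \<open>k\<close> ends at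
      \<open>t k \<le> t (Suc j)\<close>, before that of \<open>j\<close> begins.\<close>
    have aux: "{max (u j) (t (Suc j)) ..< t j} \<inter> {max (u k) (t (Suc k)) ..< t k} = {}"
      if "j < k" for j k
      using antimonoD[OF antimono_t, of "Suc j" k] that by auto
    show "\<forall>j\<in>{..<N}. \<forall>k\<in>{..<N}. j \<noteq> k \<longrightarrow>
        {max (u j) (t (Suc j)) ..< t j} \<inter> {max (u k) (t (Suc k)) ..< t k} = {}"
      by (metis aux inf_commute nat_neq_iff)
  qed auto
  moreover have "t j - max (u j) (t (Suc j)) = min (t j - u j) (t j - t (Suc j))" for j
    by auto
  ultimately show ?thesis by simp
qed

text \<open>A component is labelled by its last column: the first column \<open>k\<close>, weakly to the right of
  any of its cells, that shares no row with column \<open>k + 1\<close>.\<close>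

definition last_col :: "nat \<Rightarrow> nat" where
  "last_col j = (LEAST k. j \<le> k \<and> t (Suc k) \<le> u k)"

lemma last_col: "j \<le> last_col j" "t (Suc (last_col j)) \<le> u (last_col j)"
proof -
  \<comment> \<open>A column from \<open>N\<close> on satisfies the condition trivially, so the
    minimum exists.\<close>
  have "j \<le> max j N \<and> t (Suc (max j N)) \<le> u (max j N)"
    by (simp add: t_eq_0)
  then have "j \<le> last_col j \<and> t (Suc (last_col j)) \<le> u (last_col j)"
    unfolding last_col_def by (rule LeastI)
  then show "j \<le> last_col j" "t (Suc (last_col j)) \<le> u (last_col j)" by auto
qed

lemma last_col_self: "t (Suc j) \<le> u j \<Longrightarrow> last_col j = j"
  unfolding last_col_def by (rule Least_equality) auto

text \<open>Column \<open>j\<close> fails the stopping condition, so the search from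
  \<open>j\<close> is the search from \<open>Suc j\<close>.\<close>

lemma last_col_step: "u j < t (Suc j) \<Longrightarrow> last_col j = last_col (Suc j)"
  unfolding last_col_def by (rule arg_cong[where f = Least]) (auto simp: fun_eq_iff le_less Suc_le_eq)

abbreviation adj :: "((nat \<times> nat) \<times> (nat \<times> nat)) set" where
  "adj \<equiv> {(p, q). p \<in> cells \<and> q \<in> cells \<and> edge_adjacent p q}"

text \<open>Vertical neighbours share their column. Horizontal neighbours exhibit a row common to
  columns \<open>j\<close> and \<open>Suc j\<close>, which is what \<open>last_col_step\<close> asks
  for.\<close>

lemma last_col_adj: "(p, q) \<in> adj \<Longrightarrow> last_col (snd p) = last_col (snd q)"
proof -
  have "last_col j = last_col (Suc j)" if "(i, j) \<in> cells" "(i, Suc j) \<in> cells" for i j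
    using that by (intro last_col_step) (auto simp: cells_def)
  then show "(p, q) \<in> adj \<Longrightarrow> last_col (snd p) = last_col (snd q)"
    by (cases p; cases q) (auto simp: edge_adjacent_def)
qed

lemma column_connected: "(i, j) \<in> cells \<Longrightarrow> ((i, j), (u j, j)) \<in> adj\<^sup>*"
proof (induction i)
  case 0
  then show ?case by (simp add: cells_def)
next
  case (Suc i)
  show ?case
  proof (cases "u j = Suc i")
    case False
    with Suc.prems have "(i, j) \<in> cells" by (auto simp: cells_def)
    moreover from this have "((Suc i, j), (i, j)) \<in> adj"
      using Suc.prems by (auto simp: edge_adjacent_def)
    ultimately show ?thesis
      using Suc.IH by (meson converse_rtrancl_into_rtrancl)
  qed simp
qed

text \<open>Walk to the top cell of the column, step right, and repeat. The step stays inside the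
  shape because \<open>u (Suc j) \<le> u j < t (Suc j)\<close> until the last column is reached. The
  second conjunct says that this column is nonempty.\<close>

lemma connected_last_col:
  "(i, j) \<in> cells \<Longrightarrow>
    ((i, j), (u (last_col j), last_col j)) \<in> adj\<^sup>* \<and> u (last_col j) < t (last_col j)"
proof (induction "last_col j - j" arbitrary: i j)
  case 0
  then have "last_col j = j" using last_col(1)[of j] by simp
  with 0 column_connected show ?case by (auto simp: cells_def)
next
  case (Suc d)
  then have "u j < t (Suc j)"
    using last_col_self[of j] by fastforce
  then have eq: "last_col (Suc j) = last_col j" by (simp add: last_col_step)
  have top: "(u j, j) \<in> cells"
    using Suc.prems by (auto simp: cells_def)
  have right: "(u j, Suc j) \<in> cells"
    using \<open>u j < t (Suc j)\<close> antimonoD[OF antimono_u, of j "Suc j"] by (auto simp: cells_def)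
  have "((u j, j), (u j, Suc j)) \<in> adj"
    using top right by (auto simp: edge_adjacent_def)
  with column_connected[OF Suc.prems] have "((i, j), (u j, Suc j)) \<in> adj\<^sup>*"
    by (rule rtrancl_into_rtrancl)
  moreover have "((u j, Suc j), (u (last_col j), last_col j)) \<in> adj\<^sup>*
      \<and> u (last_col j) < t (last_col j)"
    using Suc.hyps(1)[of "Suc j" "u j"] Suc.hyps(2) right eq by simp
  ultimately show ?case by (auto intro: rtrancl_trans)
qed

text \<open>The last column is a complete invariant of components, with its top cell as base point.
  Its values are the nonempty columns that share no row with the next one.\<close>

lemma card_edge_components:
  "card (edge_components cells) = card {j. j < N \<and> u j < t j \<and> t (Suc j) \<le> u j}"
proof -
  have "card (cells // adj\<^sup>*) = card ((\<lambda>p. last_col (snd p)) ` cells)"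
  proof (rule card_quotient_rtrancl_eq_card_image[where c = "\<lambda>j. (u j, j)"])
    show "sym adj" by (auto simp: sym_def edge_adjacent_def)
    show "last_col (snd p) = last_col (snd q)" if "(p, q) \<in> adj" for p q
      using that by (rule last_col_adj)
    show "(p, (u (last_col (snd p)), last_col (snd p))) \<in> adj\<^sup>*" if "p \<in> cells" for p
      using connected_last_col[of "fst p" "snd p"] that by simp
  qed
  also have "(\<lambda>p. last_col (snd p)) ` cells = {j. j < N \<and> u j < t j \<and> t (Suc j) \<le> u j}"
  proof safe
    fix i j
    assume ij: "(i, j) \<in> cells"
    show "u (last_col (snd (i, j))) < t (last_col (snd (i, j)))"
      using connected_last_col[OF ij] by simp
    then show "last_col (snd (i, j)) < N" by (rule less_N)
    show "t (Suc (last_col (snd (i, j)))) \<le> u (last_col (snd (i, j)))"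
      by (rule last_col)
  next
    fix j
    assume "u j < t j" "t (Suc j) \<le> u j"
    then have "(u j, j) \<in> cells" "last_col (snd (u j, j)) = j"
      by (auto simp: cells_def last_col_self)
    then show "j \<in> (\<lambda>p. last_col (snd p)) ` cells" by (metis imageI)
  qed
  finally show ?thesis by (simp add: edge_components_def)
qed

section \<open>The weight of a row of vertices\<close>

lemma prod_vertex_weight:
  fixes \<alpha> \<beta> x :: "'a::comm_ring_1"
  defines "r \<equiv> card (fst ` cells)" and "c \<equiv> card (snd ` cells)"
    and "b \<equiv> card (edge_components cells)"
  shows "(\<Prod>j<N. vertex_weight \<alpha> \<beta> x (t j - u j) (u j - u (Suc j))
             (t (Suc j) - u (Suc j)) (t j - t (Suc j)))
       = \<beta> ^ (r - b) * (\<alpha> + \<beta>) ^ (((\<Sum>j<N. t j) + b) - ((\<Sum>j<N. u j) + r + c))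
           * x ^ b * (\<alpha> + x) ^ (c - b)"
proof -
  define a where "a j = t j - u j" for j
  define d where "d j = t j - t (Suc j)" for j
  \<comment> \<open>With left label \<open>a j\<close> and top label \<open>d j\<close>, these are
    the exponents of \<open>\<alpha> + \<beta>\<close>, \<open>\<alpha> + x\<close>,
    \<open>\<beta>\<close> and \<open>x\<close> in one vertex weight. For \<open>a j = 0\<close> the
    truncated \<open>a j - 1\<close> in \<open>e3\<close> gives the required exponent 0.\<close>
  define e1 where "e1 j = (if a j > d j then a j - d j - 1 else 0)" for j
  define e2 where "e2 j = (if a j > d j then 1 else 0 :: nat)" for j
  define e3 where "e3 j = (if a j > d j then d j else a j - 1)" for j
  define e4 where "e4 j = (if 0 < a j \<and> a j \<le> d j then 1 else 0 :: nat)" for j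
  have w: "vertex_weight \<alpha> \<beta> x (t j - u j) (u j - u (Suc j))
             (t (Suc j) - u (Suc j)) (t j - t (Suc j))
      = \<beta> ^ e3 j * (\<alpha> + \<beta>) ^ e1 j * x ^ e4 j * (\<alpha> + x) ^ e2 j" for j
  proof -
    \<comment> \<open>Both sides equal \<open>t j - u (Suc j)\<close>, so every vertex is
      conserving.\<close>
    have "a j + (u j - u (Suc j)) = (t (Suc j) - u (Suc j)) + d j"
      using u_le_t[of j] u_le_t[of "Suc j"] antimonoD[OF antimono_u, of j "Suc j"]
        antimonoD[OF antimono_t, of j "Suc j"] by (simp add: a_def d_def)
    then show ?thesis
      unfolding a_def[symmetric] d_def[symmetric] vertex_weight_def
      by (auto simp: e1_def e2_def e3_def e4_def algebra_simps)
  qed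
  have prod: "(\<Prod>j<N. vertex_weight \<alpha> \<beta> x (t j - u j) (u j - u (Suc j))
             (t (Suc j) - u (Suc j)) (t j - t (Suc j)))
      = \<beta> ^ (\<Sum>j<N. e3 j) * (\<alpha> + \<beta>) ^ (\<Sum>j<N. e1 j) * x ^ (\<Sum>j<N. e4 j) * (\<alpha> + x) ^ (\<Sum>j<N. e2 j)"
    by (simp add: w prod.distrib power_sum)
  have r: "r = (\<Sum>j<N. min (a j) (d j))"
    by (simp add: r_def card_rows a_def d_def)
  have c: "c = (\<Sum>j<N. of_bool (0 < a j))"
    by (auto simp: c_def card_columns a_def intro!: arg_cong[where f = card])
  have "0 < a j \<and> a j \<le> d j \<longleftrightarrow> u j < t j \<and> t (Suc j) \<le> u j" for j
    using antimonoD[OF antimono_t, of j "Suc j"] by (auto simp: a_def d_def)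
  then have b: "b = (\<Sum>j<N. e4 j)"
    by (auto simp: b_def card_edge_components e4_def sum.If_cases intro!: arg_cong[where f = card])
  have size: "(\<Sum>j<N. t j) = (\<Sum>j<N. u j) + (\<Sum>j<N. a j)"
    using u_le_t by (simp add: a_def flip: sum.distrib)
  \<comment> \<open>The three identities hold column by column, by the cases \<open>a > d\<close>,
    \<open>0 < a \<le> d\<close> and \<open>a = 0\<close>. Stated additively, they also make the
    truncated subtractions in the exponents exact.\<close>
  have "r = b + (\<Sum>j<N. e3 j)"
    unfolding r b sum.distrib[symmetric] by (rule sum.cong) (auto simp: e3_def e4_def)
  moreover have "c = b + (\<Sum>j<N. e2 j)"
    unfolding c b sum.distrib[symmetric] by (rule sum.cong) (auto simp: e2_def e4_def)
  moreover have "(\<Sum>j<N. e1 j) + r + c = (\<Sum>j<N. a j) + b"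
    unfolding r b c sum.distrib[symmetric]
    by (rule sum.cong) (auto simp: e1_def e4_def)
  ultimately have "(\<Sum>j<N. e3 j) = r - b" "(\<Sum>j<N. e2 j) = c - b"
    "(\<Sum>j<N. e1 j) = (\<Sum>j<N. t j) + b - ((\<Sum>j<N. u j) + r + c)"
    unfolding size by linarith+
  then show ?thesis
    unfolding prod by (simp flip: b)
qed

end

text \<open>Column heights turn the skew diagram into \<open>cells\<close> of the locale. The number
  \<open>sum_list la\<close> serves as a crude bound on the columns of both shapes, and site
  \<open>Suc j\<close> corresponds to column \<open>j\<close>.\<close>

lemma dual_groth_skew1_eq_prod_vertex_weight:
  assumes la: "is_partition la" and mu: "is_partition mu" and sub: "diagram mu \<subseteq> diagram la"
  shows "dual_groth_skew1 \<alpha> \<beta> la mu x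
       = (\<Prod>j<sum_list la. vertex_weight \<alpha> \<beta> x (col_height la j - col_height mu j)
            (count_list mu (Suc j)) (col_height la (Suc j) - col_height mu (Suc j))
            (count_list la (Suc j)))"
proof -
  have le: "col_height mu j \<le> col_height la j" for j
    using diagram_subset_iff_col_height[OF la mu] sub by simp
  interpret skew_columns "col_height mu" "col_height la" "sum_list la"
    by standard (auto simp: antimono_col_height le col_height_eq_0)
  have cells: "skew_diagram la mu = cells"
    by (simp add: skew_diagram_col_height[OF la mu] cells_def)
  have count: "count_list ka (Suc j) = col_height ka j - col_height ka (Suc j)" for ka j
    using col_height_Suc[of ka j] by simp
  have "p \<le> sum_list la" if "p \<in> set mu" for p
  proof (cases p)
    case (Suc q)
    with that have "col_height mu q \<noteq> 0"
      by (auto simp: col_height_def filter_empty_conv)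
    then have "\<not> sum_list la \<le> q" using le[of q] col_height_eq_0[of la q] by auto
    with Suc show ?thesis by simp
  qed simp
  then have "(\<Sum>j<sum_list la. col_height mu j) = sum_list mu"
    by (intro sum_col_height) auto
  moreover have "(\<Sum>j<sum_list la. col_height la j) = sum_list la"
    by (intro sum_col_height) (auto intro: member_le_sum_list)
  ultimately show ?thesis
    unfolding dual_groth_skew1_def Let_def nrows_def ncols_def ncomps_def cells count
    using prod_vertex_weight[of \<alpha> \<beta> x] by simp
qed

section \<open>Labelings obeying conservation\<close>

lemma prod_factors_eq_prod:
  assumes "finite F" "F \<subseteq> S" "\<And>i. i \<in> S - F \<Longrightarrow> f i = 1"
  shows "prod_factors f S = prod f F"
proof (cases "\<exists>i\<in>S. f i = 0")
  case True
  then obtain i where "i \<in> S" "f i = 0" by blast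
  \<comment> \<open>A factor outside \<open>F\<close> is 1, hence not 0.\<close>
  moreover from this have "i \<in> F" using assms(3)[of i] by auto
  ultimately have "prod f F = 0"
    using assms(1) by (intro prod_zero) auto
  with True show ?thesis by (simp add: prod_factors_def)
next
  case False
  then have "prod_factors f S = (\<Prod>i | i \<in> S \<and> f i \<noteq> 1. f i)"
    by (simp add: prod_factors_def)
  also have "\<dots> = prod f F"
    using assms by (intro prod.mono_neutral_left) auto
  finally show ?thesis .
qed

lemma prod_factors_Un:
  assumes "finite {i \<in> A. f i \<noteq> 1}" "finite {i \<in> B. f i \<noteq> 1}" "A \<inter> B = {}"
  shows "prod_factors f (A \<union> B) = prod_factors f A * prod_factors f B"
proof -
  have "prod_factors f (A \<union> B) = prod f ({i \<in> A. f i \<noteq> 1} \<union> {i \<in> B. f i \<noteq> 1})"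
    using assms by (intro prod_factors_eq_prod) auto
  also have "\<dots> = prod f {i \<in> A. f i \<noteq> 1} * prod f {i \<in> B. f i \<noteq> 1}"
    using assms by (intro prod.union_disjoint) auto
  also have "prod f {i \<in> A. f i \<noteq> 1} = prod_factors f A"
    using assms by (intro prod_factors_eq_prod[symmetric]) auto
  also have "prod f {i \<in> B. f i \<noteq> 1} = prod_factors f B"
    using assms by (intro prod_factors_eq_prod[symmetric]) auto
  finally show ?thesis .
qed

lemma prod_factors_cong:
  assumes "\<And>i. i \<in> S \<Longrightarrow> f i = g i"
  shows "prod_factors f S = prod_factors g S"
proof -
  have "{i. i \<in> S \<and> f i \<noteq> 1} = {i. i \<in> S \<and> g i \<noteq> 1}" using assms by auto
  then show ?thesis
    unfolding prod_factors_def using assms by (auto intro!: prod.cong)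
qed

text \<open>This set contains every labeling of nonzero weight, possibly with others of weight 0.
  Unlike the nonzero condition it does not involve \<open>\<alpha>\<close>, \<open>\<beta>\<close>
  and \<open>x\<close>, and it can be built up row by row.\<close>

definition conserving_labelings :: "nat \<Rightarrow> nat list \<Rightarrow> labeling set" where
  "conserving_labelings n la =
     {(h, v) \<in> labelings n (\<lambda>_. 0) (\<lambda>j. count_list la j) 0.
        \<forall>k\<in>{1..n}. \<forall>j. h (k, j) + v (k - 1, Suc j) = h (k, Suc j) + v (k, Suc j)}"

lemma labeling_weight_nonzero_conserving:
  assumes "l \<in> labelings n (\<lambda>_. 0) (\<lambda>j. count_list la j) 0" "labeling_weight \<alpha> \<beta> x n l \<noteq> 0"
  shows "l \<in> conserving_labelings n la"
proof -
  obtain h v where l: "l = (h, v)" by (cases l)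
  have "h (k, j) + v (k - 1, Suc j) = h (k, Suc j) + v (k, Suc j)" if "k \<in> {1..n}" for k j
  proof -
    have "vertex_weight \<alpha> \<beta> (x k) (h (k, Suc j - 1)) (v (k - 1, Suc j)) (h (k, Suc j)) (v (k, Suc j)) \<noteq> 0"
      using assms(2) that by (force simp: l labeling_weight_def prod_factors_def split: if_splits)
    then show ?thesis by (simp add: vertex_weight_def split: if_splits)
  qed
  with assms(1) show ?thesis by (simp add: l conserving_labelings_def)
qed

text \<open>Once the left labels have become 0, a conserving vertex falls under the case
  \<open>a = 0\<close> and has weight 1.\<close>

lemma finite_nontrivial_vertices_row:
  assumes "\<forall>\<^sub>F j in sequentially. h (k, j) = 0"
    and "\<And>j. h (k, j) + v (k - 1, Suc j) = h (k, Suc j) + v (k, Suc j)"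
  shows "finite {j. j \<ge> 1 \<and> vertex_weight \<alpha> \<beta> y (h (k, j - 1)) (v (k - 1, j)) (h (k, j)) (v (k, j)) \<noteq> 1}"
proof -
  obtain N where N: "\<And>j. j \<ge> N \<Longrightarrow> h (k, j) = 0"
    using assms(1) by (auto simp: eventually_sequentially)
  have "j \<le> N" if "j \<ge> 1"
    "vertex_weight \<alpha> \<beta> y (h (k, j - 1)) (v (k - 1, j)) (h (k, j)) (v (k, j)) \<noteq> 1" for j
  proof (rule ccontr)
    assume "\<not> j \<le> N"
    then have "h (k, j - 1) = 0" using N by auto
    moreover have "h (k, j - 1) + v (k - 1, j) = h (k, j) + v (k, j)"
      using assms(2)[of "j - 1"] that(1) by simp
    ultimately have "vertex_weight \<alpha> \<beta> y (h (k, j - 1)) (v (k - 1, j)) (h (k, j)) (v (k, j)) = 1"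
      by (simp add: vertex_weight_def)
    with that(2) show False by contradiction
  qed
  then have "{j. j \<ge> 1 \<and> vertex_weight \<alpha> \<beta> y (h (k, j - 1)) (v (k - 1, j)) (h (k, j)) (v (k, j)) \<noteq> 1} \<subseteq> {..N}"
    by auto
  then show ?thesis by (rule finite_subset) simp
qed

lemma finite_nontrivial_vertices:
  assumes "(h, v) \<in> conserving_labelings n la" "K \<subseteq> {1..n}"
  shows "finite {i \<in> K \<times> {1..}. (case i of (k, j) \<Rightarrow>
    vertex_weight \<alpha> \<beta> (x k) (h (k, j - 1)) (v (k - 1, j)) (h (k, j)) (v (k, j))) \<noteq> 1}"
    (is "finite ?A")
proof -
  have "finite (SIGMA k:K. {j. j \<ge> 1 \<and>
      vertex_weight \<alpha> \<beta> (x k) (h (k, j - 1)) (v (k - 1, j)) (h (k, j)) (v (k, j)) \<noteq> 1})"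
  proof (rule finite_SigmaI)
    show "finite K" using assms(2) finite_subset by blast
    fix k assume "k \<in> K"
    with assms show "finite {j. j \<ge> 1 \<and>
      vertex_weight \<alpha> \<beta> (x k) (h (k, j - 1)) (v (k - 1, j)) (h (k, j)) (v (k, j)) \<noteq> 1}"
      by (intro finite_nontrivial_vertices_row)
        (auto simp: conserving_labelings_def labelings_def)
  qed
  moreover have "?A \<subseteq> (SIGMA k:K. {j. j \<ge> 1 \<and>
      vertex_weight \<alpha> \<beta> (x k) (h (k, j - 1)) (v (k - 1, j)) (h (k, j)) (v (k, j)) \<noteq> 1})"
    by auto
  ultimately show ?thesis by (rule finite_subset[rotated])
qed

section \<open>Adding a row\<close>

text \<open>Row \<open>Suc n\<close> is put on top, its horizontal labels being the column heights
  of \<open>la/mu\<close>. The guard \<open>j \<ge> 1\<close> leaves the vertical label at site 0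
  undefined, as extensionality demands.\<close>

definition add_row :: "nat \<Rightarrow> nat list \<Rightarrow> nat list \<times> labeling \<Rightarrow> labeling" where
  "add_row n la = (\<lambda>(mu, h, v).
     (\<lambda>(k, j). if k = Suc n then col_height la j - col_height mu j else h (k, j),
      \<lambda>(k, j). if k = Suc n \<and> j \<ge> 1 then count_list la j else v (k, j)))"

lemma add_row_conserving:
  assumes la: "is_partition la" and mu: "is_partition mu" and sub: "diagram mu \<subseteq> diagram la"
    and hv: "(h, v) \<in> conserving_labelings n mu"
  shows "add_row n la (mu, h, v) \<in> conserving_labelings (Suc n) la"
proof -
  have le: "col_height mu j \<le> col_height la j" for j
    using diagram_subset_iff_col_height[OF la mu] sub by simp
  \<comment> \<open>Both sides are \<open>col_height la j - col_height mu (Suc j)\<close>.\<close>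
  have cons: "col_height la j - col_height mu j + count_list mu (Suc j)
      = col_height la (Suc j) - col_height mu (Suc j) + count_list la (Suc j)" for j
    using col_height_Suc[of la j] col_height_Suc[of mu j] le[of j] le[of "Suc j"] by linarith
  have ev: "\<forall>\<^sub>F j in sequentially. col_height la j - col_height mu j = 0"
    by (rule eventually_sequentiallyI[of "sum_list la"]) (simp add: col_height_eq_0)
  define h' where "h' = fst (add_row n la (mu, h, v))"
  define v' where "v' = snd (add_row n la (mu, h, v))"
  have h': "h' (k, j) = (if k = Suc n then col_height la j - col_height mu j else h (k, j))" for k j
    by (simp add: h'_def add_row_def)
  have v': "v' (k, j) = (if k = Suc n \<and> j \<ge> 1 then count_list la j else v (k, j))" for k j
    by (simp add: v'_def add_row_def)
  have hv': "h \<in> {1..n} \<times> UNIV \<rightarrow>\<^sub>E UNIV" "v \<in> {0..n} \<times> {1..} \<rightarrow>\<^sub>E UNIV"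
    "\<And>j. j \<ge> 1 \<Longrightarrow> v (0, j) = 0" "\<And>j. j \<ge> 1 \<Longrightarrow> v (n, j) = count_list mu j"
    "\<And>k. k \<in> {1..n} \<Longrightarrow> \<forall>\<^sub>F j in sequentially. h (k, j) = 0"
    "\<And>k j. k \<in> {1..n} \<Longrightarrow> h (k, j) + v (k - 1, Suc j) = h (k, Suc j) + v (k, Suc j)"
    using hv by (auto simp: conserving_labelings_def labelings_def)
  have "h' \<in> {1..Suc n} \<times> UNIV \<rightarrow>\<^sub>E UNIV"
    using hv'(1) by (auto simp: PiE_def extensional_def h')
  moreover have "v' \<in> {0..Suc n} \<times> {1..} \<rightarrow>\<^sub>E UNIV"
    using hv'(2) by (auto simp: PiE_def extensional_def v')
  moreover have "\<forall>\<^sub>F j in sequentially. h' (k, j) = 0" if "k \<in> {1..Suc n}" for k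
    using that ev hv'(5)[of k] by (cases "k = Suc n") (auto simp: h')
  moreover have "h' (k, j) + v' (k - 1, Suc j) = h' (k, Suc j) + v' (k, Suc j)"
    if "k \<in> {1..Suc n}" for k j
    using that cons[of j] hv'(4)[of "Suc j"] hv'(6)[of k j]
    by (cases "k = Suc n") (auto simp: h' v')
  ultimately have "(h', v') \<in> conserving_labelings (Suc n) la"
    using hv'(3) by (auto simp: conserving_labelings_def labelings_def v')
  then show ?thesis by (simp add: h'_def v'_def)
qed

lemma labeling_weight_add_row:
  assumes la: "is_partition la" and mu: "is_partition mu" and sub: "diagram mu \<subseteq> diagram la"
    and hv: "(h, v) \<in> conserving_labelings n mu"
  shows "labeling_weight \<alpha> \<beta> x (Suc n) (add_row n la (mu, h, v))
       = labeling_weight \<alpha> \<beta> x n (h, v) * dual_groth_skew1 \<alpha> \<beta> la mu (x (Suc n))"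
proof -
  obtain h' v' where hv': "add_row n la (mu, h, v) = (h', v')" by fastforce
  have h': "h' (k, j) = (if k = Suc n then col_height la j - col_height mu j else h (k, j))" for k j
    using hv' by (auto simp: add_row_def)
  have v': "v' (k, j) = (if k = Suc n \<and> j \<ge> 1 then count_list la j else v (k, j))" for k j
    using hv' by (auto simp: add_row_def)
  have cons: "(h', v') \<in> conserving_labelings (Suc n) la"
    using add_row_conserving[OF assms] hv' by simp
  have vn: "v (n, j) = count_list mu j" if "j \<ge> 1" for j
    using hv that by (auto simp: conserving_labelings_def labelings_def)
  define f where "f = (\<lambda>(k, j). vertex_weight \<alpha> \<beta> (x k) (h' (k, j - 1)) (v' (k - 1, j)) (h' (k, j)) (v' (k, j)))"
  have "{1..Suc n} \<times> {1::nat..} = ({1..n} \<times> {1..}) \<union> ({Suc n} \<times> {1..})"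
    by auto
  then have "labeling_weight \<alpha> \<beta> x (Suc n) (h', v')
      = prod_factors f (({1..n} \<times> {1..}) \<union> ({Suc n} \<times> {1..}))"
    by (simp add: labeling_weight_def f_def)
  also have "\<dots> = prod_factors f ({1..n} \<times> {1..}) * prod_factors f ({Suc n} \<times> {1..})"
    unfolding f_def
    by (rule prod_factors_Un; (rule finite_nontrivial_vertices[OF cons])?) auto
  \<comment> \<open>Vertices in rows up to \<open>n\<close> use only labels that
    \<open>add_row\<close> leaves unchanged.\<close>
  also have "prod_factors f ({1..n} \<times> {1..}) = labeling_weight \<alpha> \<beta> x n (h, v)"
    unfolding labeling_weight_def prod.case
    by (rule prod_factors_cong) (auto simp: f_def h' v')
  \<comment> \<open>Beyond site \<open>sum_list la\<close> the left label is 0, so the vertex has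
    weight 1.\<close>
  also have "prod_factors f ({Suc n} \<times> {1..}) = prod f ({Suc n} \<times> {1..sum_list la})"
  proof (rule prod_factors_eq_prod)
    fix i assume i: "i \<in> {Suc n} \<times> {1..} - {Suc n} \<times> {1..sum_list la}"
    then obtain j where j: "i = (Suc n, Suc j)" "sum_list la \<le> j"
      by (cases i; cases "snd i") auto
    have "h' (Suc n, j) = 0" using j(2) by (simp add: h' col_height_eq_0)
    moreover have "h' (Suc n, j) + v' (n, Suc j) = h' (Suc n, Suc j) + v' (Suc n, Suc j)"
      using cons by (force simp: conserving_labelings_def)
    ultimately show "f i = 1"
      by (simp add: f_def j vertex_weight_def)
  qed auto
  also have "\<dots> = (\<Prod>j<sum_list la. f (Suc n, Suc j))"
    by (rule prod.reindex_bij_witness[of _ "\<lambda>j. (Suc n, Suc j)" "\<lambda>i. snd i - 1"]) auto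
  also have "\<dots> = dual_groth_skew1 \<alpha> \<beta> la mu (x (Suc n))"
    unfolding dual_groth_skew1_eq_prod_vertex_weight[OF la mu sub]
    by (rule prod.cong) (auto simp: f_def h' v' vn)
  finally show ?thesis by (simp add: hv')
qed

text \<open>The vertical labels below the top row are the multiplicities of \<open>mu\<close>. They
  have finite support because the horizontal labels and the multiplicities of \<open>la\<close>
  vanish eventually.\<close>

lemma ex_remove_row:
  assumes la: "is_partition la" and l: "(h, v) \<in> conserving_labelings (Suc n) la"
  shows "\<exists>mu h0 v0. is_partition mu \<and> diagram mu \<subseteq> diagram la \<and>
    (h0, v0) \<in> conserving_labelings n mu \<and> add_row n la (mu, h0, v0) = (h, v)"
proof -
  have hv: "h \<in> {1..Suc n} \<times> UNIV \<rightarrow>\<^sub>E UNIV" "v \<in> {0..Suc n} \<times> {1..} \<rightarrow>\<^sub>E UNIV"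
    "\<And>j. j \<ge> 1 \<Longrightarrow> v (0, j) = 0" "\<And>j. j \<ge> 1 \<Longrightarrow> v (Suc n, j) = count_list la j"
    "\<And>k. k \<in> {1..Suc n} \<Longrightarrow> \<forall>\<^sub>F j in sequentially. h (k, j) = 0"
    "\<And>k j. k \<in> {1..Suc n} \<Longrightarrow> h (k, j) + v (k - 1, Suc j) = h (k, Suc j) + v (k, Suc j)"
    using l by (auto simp: conserving_labelings_def labelings_def)
  have cons: "h (Suc n, j) + v (n, Suc j) = h (Suc n, Suc j) + count_list la (Suc j)" for j
    using hv(6)[of "Suc n" j] hv(4)[of "Suc j"] by simp
  obtain N where N: "\<And>j. j \<ge> N \<Longrightarrow> h (Suc n, j) = 0"
    using hv(5)[of "Suc n"] by (auto simp: eventually_sequentially)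
  have v0: "v (n, Suc j) = 0" if "j \<ge> max N (sum_list la)" for j
    using cons[of j] N[of j] that col_height_Suc[of la j] col_height_eq_0[of la j] N[of "Suc j"]
    by auto
  have "j \<le> max N (sum_list la)" if "j \<ge> 1" "v (n, j) \<noteq> 0" for j
  proof (rule ccontr)
    assume "\<not> j \<le> max N (sum_list la)"
    then have "v (n, Suc (j - 1)) = 0" by (intro v0) auto
    with that show False by simp
  qed
  then have "{j. j \<ge> 1 \<and> v (n, j) \<noteq> 0} \<subseteq> {..max N (sum_list la)}"
    by auto
  then have "finite {j. j \<ge> 1 \<and> v (n, j) \<noteq> 0}"
    by (rule finite_subset) simp
  from ex_partition_count_list[OF this] obtain mu where
    mu: "is_partition mu" and vn: "\<And>j. j \<ge> 1 \<Longrightarrow> count_list mu j = v (n, j)" by blast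
  \<comment> \<open>Conservation is summed from the right: at column \<open>M\<close> all three
    terms vanish, and downward induction carries the identity to \<open>j\<close>.\<close>
  have height: "col_height la j = h (Suc n, j) + col_height mu j" for j
  proof -
    define M where "M = max j (N + sum_list la + sum_list mu)"
    have "j \<le> M" by (simp add: M_def)
    then show ?thesis
    proof (induction j rule: inc_induct)
      case base
      then show ?case by (simp add: M_def col_height_eq_0 N)
    next
      case (step j)
      then show ?case
        using col_height_Suc[of la j] col_height_Suc[of mu j] cons[of j] vn[of "Suc j"] by simp
    qed
  qed
  have sub: "diagram mu \<subseteq> diagram la"
    unfolding diagram_subset_iff_col_height[OF la mu] by (simp add: height)
  define h0 where "h0 = restrict h ({1..n} \<times> UNIV)"
  define v0 where "v0 = restrict v ({0..n} \<times> {1..})"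
  have "(h0, v0) \<in> conserving_labelings n mu"
  proof -
    have "\<forall>\<^sub>F j in sequentially. h0 (k, j) = 0" if "k \<in> {1..n}" for k
      using hv(5)[of k] that by (simp add: h0_def)
    moreover have "h0 (k, j) + v0 (k - 1, Suc j) = h0 (k, Suc j) + v0 (k, Suc j)"
      if "k \<in> {1..n}" for k j
      using hv(6)[of k j] that by (auto simp: h0_def v0_def)
    ultimately show ?thesis
      using hv(3) vn by (auto simp: conserving_labelings_def labelings_def h0_def v0_def)
  qed
  moreover have "add_row n la (mu, h0, v0) = (h, v)"
  proof -
    have "(if k = Suc n then col_height la j - col_height mu j else h0 (k, j)) = h (k, j)" for k j
      using hv(1) by (auto simp: height h0_def PiE_def extensional_def)
    moreover have "(if k = Suc n \<and> j \<ge> 1 then count_list la j else v0 (k, j)) = v (k, j)" for k j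
      using hv(2,4) by (auto simp: v0_def PiE_def extensional_def)
    ultimately show ?thesis by (simp add: add_row_def fun_eq_iff)
  qed
  ultimately show ?thesis using mu sub by blast
qed

lemma bij_betw_add_row:
  assumes la: "is_partition la"
  shows "bij_betw (add_row n la)
    (SIGMA mu:{mu. is_partition mu \<and> diagram mu \<subseteq> diagram la}. conserving_labelings n mu)
    (conserving_labelings (Suc n) la)"
  unfolding bij_betw_def
proof
  show "inj_on (add_row n la)
    (SIGMA mu:{mu. is_partition mu \<and> diagram mu \<subseteq> diagram la}. conserving_labelings n mu)"
  proof (rule inj_onI)
    fix p q
    assume p: "p \<in> (SIGMA mu:{mu. is_partition mu \<and> diagram mu \<subseteq> diagram la}.
          conserving_labelings n mu)"
      and q: "q \<in> (SIGMA mu:{mu. is_partition mu \<and> diagram mu \<subseteq> diagram la}.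
          conserving_labelings n mu)"
      and pq: "add_row n la p = add_row n la q"
    obtain mu h v where p_eq: "p = (mu, h, v)" using prod_cases3 by blast
    obtain mu' h' v' where q_eq: "q = (mu', h', v')" using prod_cases3 by blast
    have mu: "is_partition mu" "is_partition mu'"
      and hv: "(h, v) \<in> conserving_labelings n mu" "(h', v') \<in> conserving_labelings n mu'"
      and eq: "add_row n la (mu, h, v) = add_row n la (mu', h', v')"
      using p q pq by (auto simp: p_eq q_eq)
    have h: "h (k, j) = h' (k, j)" if "k \<noteq> Suc n" for k j
      using eq that by (auto simp: add_row_def fun_eq_iff split: if_splits)
    have v: "v (k, j) = v' (k, j)" if "k \<noteq> Suc n" for k j
      using eq that by (auto simp: add_row_def fun_eq_iff split: if_splits)
    \<comment> \<open>These positions lie outside the domains for \<open>n\<close> rows, so both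
      sides are \<open>undefined\<close>.\<close>
    have ext: "h (Suc n, j) = h' (Suc n, j)" "v (Suc n, j) = v' (Suc n, j)" for j
      using hv by (auto simp: conserving_labelings_def labelings_def PiE_def extensional_def)
    have "h = h'"
    proof
      fix i show "h i = h' i" using h ext by (cases i; cases "fst i = Suc n") auto
    qed
    moreover have "v = v'"
    proof
      fix i show "v i = v' i" using v ext by (cases i; cases "fst i = Suc n") auto
    qed
    \<comment> \<open>The vertical labels above row \<open>n\<close> give the multiplicities of both
      partitions.\<close>
    moreover have "mu = mu'"
      using mu hv v[of n] by (intro partition_eqI) (auto simp: conserving_labelings_def labelings_def)
    ultimately show "p = q" by (simp add: p_eq q_eq)
  qed
  show "add_row n la `
    (SIGMA mu:{mu. is_partition mu \<and> diagram mu \<subseteq> diagram la}. conserving_labelings n mu)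
      = conserving_labelings (Suc n) la"
  proof
    show "conserving_labelings (Suc n) la \<subseteq> add_row n la `
      (SIGMA mu:{mu. is_partition mu \<and> diagram mu \<subseteq> diagram la}. conserving_labelings n mu)"
    proof
      fix l assume "l \<in> conserving_labelings (Suc n) la"
      then obtain mu h0 v0 where "is_partition mu" "diagram mu \<subseteq> diagram la"
        "(h0, v0) \<in> conserving_labelings n mu" "add_row n la (mu, h0, v0) = l"
        using ex_remove_row[OF la, of "fst l" "snd l" n] by auto
      then show "l \<in> add_row n la `
        (SIGMA mu:{mu. is_partition mu \<and> diagram mu \<subseteq> diagram la}. conserving_labelings n mu)"
        by (intro image_eqI[where x = "(mu, h0, v0)"]) auto
    qed
  qed (auto intro: add_row_conserving[OF la])
qed

section \<open>Summation over all labelings\<close>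

lemma conserving_labelings_0:
  assumes "is_partition la"
  shows "conserving_labelings 0 la
    = (if la = [] then {(\<lambda>_. undefined, restrict (\<lambda>_. 0) ({0} \<times> {1..}))} else {})"
proof (cases "la = []")
  case True
  have "v = restrict (\<lambda>_. 0) ({0} \<times> {1..})"
    if "v \<in> {0} \<times> {1..} \<rightarrow>\<^sub>E (UNIV :: nat set)" "\<forall>j\<ge>1. v (0, j) = 0" for v :: "nat \<times> nat \<Rightarrow> nat"
    using that by (intro extensionalityI[where A = "{0} \<times> {1..}"]) (auto simp: PiE_def)
  moreover have "restrict (\<lambda>_. 0) ({0} \<times> {1..}) \<in> {0} \<times> {1..} \<rightarrow>\<^sub>E (UNIV :: nat set)"
    by (simp add: restrict_def PiE_def extensional_def)
  ultimately show ?thesis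
    using True by (auto simp: conserving_labelings_def labelings_def split: if_splits)
next
  case False
  have "False" if "(h, v) \<in> conserving_labelings 0 la" for h v
  proof -
    \<comment> \<open>Without rows, the bottom and top boundaries are the same labels.\<close>
    have "count_list la j = count_list [] j" if "j \<ge> 1" for j
      using \<open>(h, v) \<in> _\<close> that by (auto simp: conserving_labelings_def labelings_def)
    then have "la = []"
      using assms by (intro partition_eqI) (auto simp: is_partition_def)
    with False show False by contradiction
  qed
  with False show ?thesis by auto
qed

text \<open>Removing the top row turns the sum for \<open>Suc n\<close> rows into the branching
  rule. Finiteness is part of the induction, since the double sum needs finite inner index
  sets.\<close>

lemma sum_conserving_labelings:
  assumes "is_partition la"
  shows "finite (conserving_labelings n la) \<and>
    (\<Sum>l\<in>conserving_labelings n la. labeling_weight \<alpha> \<beta> x n l) = dual_groth \<alpha> \<beta> x n la"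
  using assms
proof (induction n arbitrary: la)
  case 0
  then show ?case
    by (simp add: conserving_labelings_0 labeling_weight_def prod_factors_def)
next
  case (Suc n)
  define A where "A = {mu. is_partition mu \<and> diagram mu \<subseteq> diagram la}"
  have A: "finite A" by (simp add: A_def finite_subpartitions)
  have fin: "finite (conserving_labelings n mu)" if "mu \<in> A" for mu
    using Suc.IH[of mu] that by (simp add: A_def)
  have bij: "bij_betw (add_row n la) (SIGMA mu:A. conserving_labelings n mu)
      (conserving_labelings (Suc n) la)"
    unfolding A_def by (rule bij_betw_add_row[OF Suc.prems])
  have "finite (conserving_labelings (Suc n) la)"
    using bij_betw_finite[OF bij] A fin by auto
  moreover have "(\<Sum>l\<in>conserving_labelings (Suc n) la. labeling_weight \<alpha> \<beta> x (Suc n) l)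
      = (\<Sum>p\<in>(SIGMA mu:A. conserving_labelings n mu). labeling_weight \<alpha> \<beta> x (Suc n) (add_row n la p))"
    by (rule sum.reindex_bij_betw[OF bij, symmetric])
  moreover have "\<dots> = (\<Sum>(mu, l)\<in>(SIGMA mu:A. conserving_labelings n mu).
      labeling_weight \<alpha> \<beta> x n l * dual_groth_skew1 \<alpha> \<beta> la mu (x (Suc n)))"
    by (rule sum.cong) (auto simp: A_def labeling_weight_add_row[OF Suc.prems])
  moreover have "\<dots> = (\<Sum>mu\<in>A. \<Sum>l\<in>conserving_labelings n mu.
      labeling_weight \<alpha> \<beta> x n l * dual_groth_skew1 \<alpha> \<beta> la mu (x (Suc n)))"
    using A fin by (intro sum.Sigma[symmetric]) auto
  moreover have "\<dots> = (\<Sum>mu\<in>A. dual_groth \<alpha> \<beta> x n mu * dual_groth_skew1 \<alpha> \<beta> la mu (x (Suc n)))"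
    using Suc.IH by (intro sum.cong) (auto simp: A_def simp flip: sum_distrib_right)
  ultimately show ?case by (simp add: A_def)
qed

theorem theorem2p2:
  fixes \<alpha> \<beta> :: "'a::comm_ring_1" and x :: "nat \<Rightarrow> 'a" and n :: nat and la :: "nat list"
  assumes "n \<ge> 1" and "is_partition la"
  shows "dual_groth \<alpha> \<beta> x n la
       = partition_function \<alpha> \<beta> x n (\<lambda>_. 0) (\<lambda>j. count_list la j) 0"
proof -
  have "partition_function \<alpha> \<beta> x n (\<lambda>_. 0) (\<lambda>j. count_list la j) 0
      = (\<Sum>l\<in>conserving_labelings n la. labeling_weight \<alpha> \<beta> x n l)"
    unfolding partition_function_def
  \<comment> \<open>The conserving labelings not in the partition function have weight 0.\<close>
  proof (rule sum.mono_neutral_left)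
    show "finite (conserving_labelings n la)"
      using sum_conserving_labelings[OF assms(2)] by blast
    show "{l \<in> labelings n (\<lambda>_. 0) (\<lambda>j. count_list la j) 0. labeling_weight \<alpha> \<beta> x n l \<noteq> 0}
        \<subseteq> conserving_labelings n la"
      by (auto intro: labeling_weight_nonzero_conserving)
  qed (auto simp: conserving_labelings_def)
  then show ?thesis
    using sum_conserving_labelings[OF assms(2)] by metis
qed

end
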